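(* Let $A \in \mathbb{C}^{n\times n}$ be a normal matrix, and let $U$ be the unitary matrix returned by the algorithm RandDiag applied to $A$ in exact arithmetic; that is, $U$ is a unitary matrix such that $U^*(\mu_H H + \mu_S\, \mathrm{i} S)U$ is diagonal, where $H = (A+A^* )/2$, $S = (A-A^* )/2$, and $\mu_H, \mu_S \sim \mathcal{N}(0,1)$ are independent. Then, with probability $1$, $U$ diagonalizes $A$, that is, $U^* A U$ is diagonal.
   Context: $A^*$ denotes the Hermitian (conjugate) transpose of $A$; $A$ is normal if $AA^* = A^*A$; $\mathrm{i}$ is the imaginary unit. The algorithm RandDiag, for an input $A \in \mathbb{C}^{n\times n}$, does the following: (1) compute $H = (A+A^* )/2$ and $S = (A-A^* )/2$ (so $H$ and $\mathrm{i}S$ are Hermitian); (2) draw two independent real standard normal random variables $\mu_H, \mu_S \sim \mathcal{N}(0,1)$; (3) compute and return a unitary matrix $U$ such that $U^*(\mu_H H + \mu_S\, \mathrm{i} S)U$ is diagonal. No particular choice of diagonalizing unitary matrix is prescribed in step (3); it may depend on the realized values of $\mu_H, \mu_S$. Probability is with respect to $(\mu_H,\mu_S)$. *)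

theory Defs
  imports "HOL-Probability.Probability" "Jordan_Normal_Form.Schur_Decomposition"
begin

definition normal_mat :: "complex mat \<Rightarrow> bool" where
  "normal_mat A \<longleftrightarrow> square_mat A \<and> A * mat_adjoint A = mat_adjoint A * A"

definition unitary_mat :: "complex mat \<Rightarrow> bool" where
  "unitary_mat U \<longleftrightarrow> square_mat U \<and>
     mat_adjoint U * U = 1\<^sub>m (dim_row U) \<and> U * mat_adjoint U = 1\<^sub>m (dim_row U)"

definition herm_part :: "complex mat \<Rightarrow> complex mat" where
  "herm_part A = (1 / 2) \<cdot>\<^sub>m (A + mat_adjoint A)"

definition skew_part :: "complex mat \<Rightarrow> complex mat" where
  "skew_part A = (1 / 2) \<cdot>\<^sub>m (A - mat_adjoint A)"

definition diagonalizes :: "complex mat \<Rightarrow> complex mat \<Rightarrow> bool" where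
  "diagonalizes U B \<longleftrightarrow> diagonal_mat (mat_adjoint U * B * U)"

(* The diagonalizing unitary is not prescribed by RandDiag, so the algorithm is modelled as the
   relation between the input A, the drawn values a (for mu_H) and b (for mu_S), and an
   admissible output U. *)
definition rand_diag_output :: "complex mat \<Rightarrow> real \<Rightarrow> real \<Rightarrow> complex mat \<Rightarrow> bool" where
  "rand_diag_output A a b U \<longleftrightarrow>
     U \<in> carrier_mat (dim_row A) (dim_row A) \<and> unitary_mat U \<and>
     diagonalizes U
       (complex_of_real a \<cdot>\<^sub>m herm_part A + complex_of_real b \<cdot>\<^sub>m (\<i> \<cdot>\<^sub>m skew_part A))"

end

theory Submission
  imports Defs "Jordan_Normal_Form.Spectral_Radius"
begin

text \<open>
  Write \<open>N\<close> for the random Hermitian matrix \<open>\<mu>\<^sub>H H + \<mu>\<^sub>S \<i>S\<close> that the algorithm diagonalizes. A normal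
  matrix \<open>A\<close> has an orthonormal eigenbasis (\<open>normal_mat_unitarily_diagonalizable\<close>), and a vector of
  that basis with eigenvalue \<open>\<lambda>\<close> is an eigenvector of \<open>N\<close> with eigenvalue
  \<open>\<theta> \<lambda> = \<mu>\<^sub>H Re \<lambda> - \<mu>\<^sub>S Im \<lambda>\<close>, because it is an eigenvector of \<open>H\<close> and of \<open>\<i>S\<close> with
  eigenvalues \<open>Re \<lambda>\<close> and \<open>- Im \<lambda>\<close> (\<open>unitary_conj_combination\<close>).

  The only way in which a diagonalization of \<open>N\<close> can fail to diagonalize \<open>A\<close> is that \<open>\<theta>\<close> merges two
  different eigenvalues of \<open>A\<close>: if it does not, each eigenspace of \<open>N\<close> is an eigenspace of \<open>A\<close>, so
  every eigenbasis of \<open>N\<close>, whichever one the algorithm picks, is an eigenbasis of \<open>A\<close>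
  (\<open>diagonalizes_of_coarser_diagonalization\<close>).

  For a fixed pair of eigenvalues \<open>\<lambda> \<noteq> \<lambda>'\<close>, the equation \<open>\<theta> \<lambda> = \<theta> \<lambda>'\<close> says that \<open>(\<mu>\<^sub>H, \<mu>\<^sub>S)\<close> lies on a
  certain line through the origin. The pair has a density in the plane, so this has probability
  zero (\<open>AE_nontrivial_linear_combination_nonzero\<close>), and there are only finitely many such pairs.
  The exceptional event is expressed by the eigenvalues of \<open>A\<close> alone, so a single null event covers
  every way of choosing \<open>U\<close> from the sample.
\<close>

section \<open>Adjoints and unitary conjugation\<close>

lemma dim_mat_adjoint [simp]:
  "dim_row (mat_adjoint A) = dim_col A" "dim_col (mat_adjoint A) = dim_row A"
  by (simp_all add: mat_adjoint_def)

lemma mat_adjoint_carrier [simp]: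
  "A \<in> carrier_mat n m \<Longrightarrow> mat_adjoint A \<in> carrier_mat m n"
  by (intro carrier_matI) auto

lemma index_mat_adjoint [simp]:
  fixes A :: "complex mat"
  assumes "i < dim_col A" "j < dim_row A"
  shows "mat_adjoint A $$ (i, j) = cnj (A $$ (j, i))"
  using assms by (simp add: mat_adjoint_def mat_of_rows_def conjugate_complex_def)

lemma mat_adjoint_adjoint [simp]: "mat_adjoint (mat_adjoint (A :: complex mat)) = A"
  by (rule eq_matI) simp_all

lemma index_mult_mat_sum:
  fixes A B :: "complex mat"
  assumes "A \<in> carrier_mat n m" "B \<in> carrier_mat m l" "i < n" "j < l"
  shows "(A * B) $$ (i, j) = (\<Sum>k<m. A $$ (i, k) * B $$ (k, j))"
  using assms by (auto simp: scalar_prod_def atLeast0LessThan intro!: sum.cong)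

lemma mat_adjoint_mult:
  fixes A B :: "complex mat"
  assumes A: "A \<in> carrier_mat n m" and B: "B \<in> carrier_mat m l"
  shows "mat_adjoint (A * B) = mat_adjoint B * mat_adjoint A"
proof (rule eq_matI)
  fix i j assume "i < dim_row (mat_adjoint B * mat_adjoint A)"
    and "j < dim_col (mat_adjoint B * mat_adjoint A)"
  with A B have ij: "i < l" "j < n" by auto
  have "mat_adjoint (A * B) $$ (i, j) = cnj ((A * B) $$ (j, i))"
    using A B ij by (intro index_mat_adjoint) auto
  also have "\<dots> = (\<Sum>k<m. cnj (A $$ (j, k)) * cnj (B $$ (k, i)))"
    using index_mult_mat_sum[OF A B ij(2,1)] by simp
  also have "\<dots> = (\<Sum>k<m. mat_adjoint B $$ (i, k) * mat_adjoint A $$ (k, j))"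
    using A B ij by (intro sum.cong) auto
  also have "\<dots> = (mat_adjoint B * mat_adjoint A) $$ (i, j)"
    by (rule index_mult_mat_sum[symmetric, OF mat_adjoint_carrier[OF B] mat_adjoint_carrier[OF A] ij])
  finally show "mat_adjoint (A * B) $$ (i, j) = (mat_adjoint B * mat_adjoint A) $$ (i, j)" .
qed (use A B in auto)

lemma unitary_matI:
  assumes U: "U \<in> carrier_mat n n" and "mat_adjoint U * U = 1\<^sub>m n"
  shows "unitary_mat U"
  using assms mat_mult_left_right_inverse[OF mat_adjoint_carrier[OF U] U]
  by (auto simp: unitary_mat_def square_mat.simps)

lemma unitary_matD:
  assumes "unitary_mat U" "U \<in> carrier_mat n n"
  shows "mat_adjoint U * U = 1\<^sub>m n" "U * mat_adjoint U = 1\<^sub>m n"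
  using assms by (auto simp: unitary_mat_def)

lemma unitary_mat_mult:
  assumes "unitary_mat U" "unitary_mat V" and U: "U \<in> carrier_mat n n" and V: "V \<in> carrier_mat n n"
  shows "unitary_mat (U * V)"
proof (rule unitary_matI)
  have "mat_adjoint (U * V) * (U * V) = mat_adjoint V * ((mat_adjoint U * U) * V)"
    using U V by (simp add: mat_adjoint_mult[OF U V] assoc_mult_mat[of _ n n _ n _ n]
        mult_carrier_mat[of _ n n _ n])
  then show "mat_adjoint (U * V) * (U * V) = 1\<^sub>m n"
    using unitary_matD[OF assms(1) U] unitary_matD[OF assms(2) V] V by simp
qed (use U V in simp)

lemma unitary_mult_adjoint_cancel:
  assumes "unitary_mat U" and U: "U \<in> carrier_mat n n" and X: "X \<in> carrier_mat n m"
  shows "U * (mat_adjoint U * X) = X"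
proof -
  have "U * (mat_adjoint U * X) = (U * mat_adjoint U) * X"
    using U X by (simp add: assoc_mult_mat[of _ n n _ n _ m])
  then show ?thesis using unitary_matD[OF assms(1) U] X by simp
qed

lemma mat_adjoint_conj:
  fixes A V :: "complex mat"
  assumes A: "A \<in> carrier_mat n n" and V: "V \<in> carrier_mat n n"
  shows "mat_adjoint (mat_adjoint V * A * V) = mat_adjoint V * mat_adjoint A * V"
  using A V by (simp add: mat_adjoint_mult[of _ n n _ n] assoc_mult_mat[of _ n n _ n _ n]
        mult_carrier_mat[of _ n n _ n])

lemma unitary_conj_mult:
  assumes "unitary_mat V" and V: "V \<in> carrier_mat n n"
    and A: "A \<in> carrier_mat n n" and B: "B \<in> carrier_mat n n"
  shows "(mat_adjoint V * A * V) * (mat_adjoint V * B * V) = mat_adjoint V * (A * B) * V"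
  using V A B unitary_mult_adjoint_cancel[OF assms(1) V, of "B * V" n]
  by (simp add: assoc_mult_mat[of _ n n _ n _ n] mult_carrier_mat[of _ n n _ n])

lemma normal_mat_unitary_conj:
  assumes "normal_mat A" "unitary_mat V" and A: "A \<in> carrier_mat n n" and V: "V \<in> carrier_mat n n"
  shows "normal_mat (mat_adjoint V * A * V)"
  using assms by (simp add: normal_mat_def mat_adjoint_conj unitary_conj_mult square_mat.simps)

section \<open>The spectral theorem for normal matrices\<close>

text \<open>
  The splitting step of the induction for the spectral theorem: over the complex numbers there is an
  eigenvector, and Gram--Schmidt extends it to an orthogonal basis that starts with it. Once the
  basis is normalized, it gives a unitary matrix whose first column is an eigenvector.
\<close>
lemma exists_unitary_eigenvector_column:
  fixes A :: "complex mat"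
  assumes A: "A \<in> carrier_mat n n" and n: "n > 0"
  shows "\<exists>W e. W \<in> carrier_mat n n \<and> unitary_mat W \<and>
    (\<forall>i<n. (mat_adjoint W * A * W) $$ (i, 0) = (if i = 0 then e else 0))"
proof -
  obtain e where "eigenvalue A e"
    using spectrum_non_empty[OF A n] by (auto simp: spectrum_def)
  then obtain v where "eigenvector A v e" by (auto simp: eigenvalue_def)
  then have v: "v \<in> carrier_vec n" and v0: "v \<noteq> 0\<^sub>v n" and ev: "A *\<^sub>v v = e \<cdot>\<^sub>v v"
    using A by (auto simp: eigenvector_def)
  interpret cof_vec_space n "TYPE(complex)" .
  define ws where "ws = gram_schmidt n (basis_completion v)"
  note bc = basis_completion[OF v v0]
  have ws: "set ws \<subseteq> carrier_vec n" "corthogonal ws" "length ws = n"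
    using gram_schmidt_result[OF bc(2,4,5) refl] bc(6) by (auto simp: ws_def)
  obtain vs where bv: "basis_completion v = v # vs"
    using bc(6,7) n by (cases "basis_completion v") auto
  have "hd ws = v"
    using gram_schmidt_hd[OF v, of vs] by (simp add: ws_def bv)
  then have ws0: "ws ! 0 = v" using ws(3) n by (simp add: hd_conv_nth flip: length_greater_0_conv)
  have wsc: "ws ! i \<in> carrier_vec n" if "i < n" for i using ws that by auto
  \<comment> \<open>The Gram--Schmidt vectors are orthogonal but not normalized; \<open>c i\<close> is the squared norm of the
    \<open>i\<close>-th one.\<close>
  define c where "c i = (\<Sum>k<n. (cmod (ws ! i $ k))\<^sup>2)" for i
  have ip: "(\<Sum>k<n. cnj (ws ! i $ k) * ws ! j $ k) = (if i = j then of_real (c i) else 0)"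
    if "i < n" "j < n" for i j
  proof (cases "i = j")
    case True
    then show ?thesis
      by (simp add: c_def complex_norm_square mult.commute del: of_real_power)
  next
    case False
    then have "ws ! j \<bullet>c ws ! i = 0" using corthogonalD[OF ws(2)] that ws(3) by auto
    then show ?thesis using False wsc[OF that(1)]
      by (simp add: scalar_prod_def conjugate_complex_def atLeast0LessThan mult.commute)
  qed
  have cpos: "c i > 0" if "i < n" for i
  proof -
    have "ws ! i \<bullet>c ws ! i \<noteq> 0" using corthogonalD[OF ws(2)] that ws(3) by auto
    moreover have "ws ! i \<bullet>c ws ! i = of_real (c i)"
      using ip[OF that that] wsc[OF that]
      by (simp add: scalar_prod_def conjugate_complex_def atLeast0LessThan mult.commute)
    ultimately have "c i \<noteq> 0" by auto
    moreover have "c i \<ge> 0" unfolding c_def by (intro sum_nonneg) auto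
    ultimately show ?thesis by simp
  qed
  define W where "W = Matrix.mat n n (\<lambda>(i, j). ws ! j $ i / of_real (sqrt (c j)))"
  have W: "W \<in> carrier_mat n n" by (simp add: W_def)
  have WW: "mat_adjoint W * W = 1\<^sub>m n"
  proof (rule eq_matI)
    fix i j assume "i < dim_row (1\<^sub>m n :: complex mat)" "j < dim_col (1\<^sub>m n :: complex mat)"
    then have ij: "i < n" "j < n" by auto
    have "(mat_adjoint W * W) $$ (i, j) =
        (\<Sum>k<n. cnj (ws ! i $ k) * ws ! j $ k) / of_real (sqrt (c i) * sqrt (c j))"
      using ij W unfolding index_mult_mat_sum[OF mat_adjoint_carrier[OF W] W ij]
      by (auto simp: W_def sum_divide_distrib intro!: sum.cong)
    also have "\<dots> = (1\<^sub>m n :: complex mat) $$ (i, j)"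
      using ij cpos[OF ij(1)] cpos[OF ij(2)] by (auto simp: ip simp flip: of_real_mult)
    finally show "(mat_adjoint W * W) $$ (i, j) = (1\<^sub>m n :: complex mat) $$ (i, j)" .
  qed (use W in auto)
  have AW: "(A * W) $$ (i, 0) = e * W $$ (i, 0)" if i: "i < n" for i
  proof -
    have "(A * W) $$ (i, 0) = (\<Sum>k<n. A $$ (i, k) * v $ k) / of_real (sqrt (c 0))"
      unfolding index_mult_mat_sum[OF A W i n] using n
      by (simp add: W_def ws0 sum_divide_distrib)
    also have "(\<Sum>k<n. A $$ (i, k) * v $ k) = (A *\<^sub>v v) $ i"
      using A v i by (auto simp: scalar_prod_def atLeast0LessThan intro!: sum.cong)
    finally show ?thesis using ev v i n by (simp add: W_def ws0)
  qed
  have "(mat_adjoint W * A * W) $$ (i, 0) = (if i = 0 then e else 0)" if i: "i < n" for i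
  proof -
    have "(mat_adjoint W * A * W) $$ (i, 0) = (mat_adjoint W * (A * W)) $$ (i, 0)"
      using A W by (simp add: assoc_mult_mat[of _ n n _ n _ n] mult_carrier_mat[of _ n n _ n])
    also have "\<dots> = e * (mat_adjoint W * W) $$ (i, 0)"
      unfolding index_mult_mat_sum[OF mat_adjoint_carrier[OF W] mult_carrier_mat[OF A W] i n]
        index_mult_mat_sum[OF mat_adjoint_carrier[OF W] W i n]
      by (simp add: AW sum_distrib_left mult_ac)
    finally show ?thesis using i n by (simp add: WW)
  qed
  then show ?thesis using W unitary_matI[OF W WW] by blast
qed

text \<open>
  For a normal matrix, \<open>A A\<^sup>* = A\<^sup>* A\<close> at entry \<open>(0, 0)\<close> says that the first row and the first column
  have the same norm. If the column consists of its diagonal entry only, nothing is left for the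
  rest of the row.
\<close>
lemma normal_mat_first_row_zero:
  assumes A: "A \<in> carrier_mat n n" and "normal_mat A"
    and col: "\<And>i. 0 < i \<Longrightarrow> i < n \<Longrightarrow> A $$ (i, 0) = 0" and j: "0 < j" "j < n"
  shows "A $$ (0, j) = 0"
proof -
  have n: "0 < n" using j by simp
  have "(\<Sum>k<n. (cmod (A $$ (0, k)))\<^sup>2) = (\<Sum>k<n. (cmod (A $$ (k, 0)))\<^sup>2)"
  proof -
    have "(A * mat_adjoint A) $$ (0, 0) = (mat_adjoint A * A) $$ (0, 0)"
      using assms(2) by (simp add: normal_mat_def)
    then have "(\<Sum>k<n. A $$ (0, k) * cnj (A $$ (0, k))) = (\<Sum>k<n. cnj (A $$ (k, 0)) * A $$ (k, 0))"
      unfolding index_mult_mat_sum[OF A mat_adjoint_carrier[OF A] n n]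
        index_mult_mat_sum[OF mat_adjoint_carrier[OF A] A n n]
      using A n by simp
    then have "complex_of_real (\<Sum>k<n. (cmod (A $$ (0, k)))\<^sup>2) =
        complex_of_real (\<Sum>k<n. (cmod (A $$ (k, 0)))\<^sup>2)"
      by (simp add: complex_norm_square mult.commute del: of_real_power)
    then show ?thesis by (simp only: of_real_eq_iff)
  qed
  also have "\<dots> = (\<Sum>k\<in>{0}. (cmod (A $$ (k, 0)))\<^sup>2)"
    using n col by (intro sum.mono_neutral_right) auto
  finally have "(\<Sum>k\<in>{..<n} - {0}. (cmod (A $$ (0, k)))\<^sup>2) = 0"
    using n by (simp add: sum.remove[of "{..<n}" 0])
  then have "\<forall>k\<in>{..<n} - {0}. (cmod (A $$ (0, k)))\<^sup>2 = 0"
    by (subst (asm) sum_nonneg_eq_0_iff) auto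
  then show ?thesis using j by simp
qed

lemma mat_adjoint_block_diag:
  fixes A D :: "complex mat"
  assumes A: "A \<in> carrier_mat n n" and D: "D \<in> carrier_mat m m"
  shows "mat_adjoint (four_block_mat A (0\<^sub>m n m) (0\<^sub>m m n) D) =
    four_block_mat (mat_adjoint A) (0\<^sub>m n m) (0\<^sub>m m n) (mat_adjoint D)"
  using A D by (intro eq_matI) auto

lemma block_diag_mult:
  fixes A D :: "complex mat"
  assumes "A \<in> carrier_mat n n" "D \<in> carrier_mat m m" "A' \<in> carrier_mat n n" "D' \<in> carrier_mat m m"
  shows "four_block_mat A (0\<^sub>m n m) (0\<^sub>m m n) D * four_block_mat A' (0\<^sub>m n m) (0\<^sub>m m n) D' =
    four_block_mat (A * A') (0\<^sub>m n m) (0\<^sub>m m n) (D * D')"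
  using assms by (subst mult_four_block_mat[of _ n n _ m _ m _ _ n _ m]) auto

lemma block_diag_inject:
  fixes D D' :: "complex mat"
  assumes "A \<in> carrier_mat n n" "D \<in> carrier_mat m m" "A' \<in> carrier_mat n n" "D' \<in> carrier_mat m m"
    and eq: "four_block_mat A (0\<^sub>m n m) (0\<^sub>m m n) D = four_block_mat A' (0\<^sub>m n m) (0\<^sub>m m n) D'"
  shows "D = D'"
proof (rule eq_matI)
  fix i j assume "i < dim_row D'" "j < dim_col D'"
  then show "D $$ (i, j) = D' $$ (i, j)"
    using assms(1-4) arg_cong[OF eq, of "\<lambda>M. M $$ (n + i, n + j)"] by auto
qed (use assms(1-4) in auto)

text \<open>
  Induction on the size: conjugating with a unitary matrix that has an eigenvector as its first column
  clears the first column, normality then clears the first row, and the remaining block is again normal.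
\<close>
theorem normal_mat_unitarily_diagonalizable:
  assumes "A \<in> carrier_mat n n" "normal_mat A"
  shows "\<exists>V. V \<in> carrier_mat n n \<and> unitary_mat V \<and> diagonalizes V A"
  using assms
proof (induction n arbitrary: A)
  case 0
  then have "diagonalizes (1\<^sub>m 0) A" "unitary_mat (1\<^sub>m 0)"
    by (auto simp: diagonalizes_def diagonal_mat_def intro!: unitary_matI[of _ 0] eq_matI)
  then show ?case by (intro exI[of _ "1\<^sub>m 0"]) auto
next
  case (Suc m)
  note A = Suc.prems(1)
  obtain W e where W: "W \<in> carrier_mat (Suc m) (Suc m)" and uW: "unitary_mat W"
    and col: "\<And>i. i < Suc m \<Longrightarrow> (mat_adjoint W * A * W) $$ (i, 0) = (if i = 0 then e else 0)"
    using exists_unitary_eigenvector_column[OF A] by auto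
  define B where "B = mat_adjoint W * A * W"
  have B: "B \<in> carrier_mat (Suc m) (Suc m)" using A W by (auto simp: B_def)
  have nB: "normal_mat B"
    unfolding B_def by (rule normal_mat_unitary_conj[OF Suc.prems(2) uW A W])
  have row: "B $$ (0, j) = 0" if "0 < j" "j < Suc m" for j
    by (rule normal_mat_first_row_zero[OF B nB _ that]) (simp add: B_def col)
  define E where "E = Matrix.mat 1 1 (\<lambda>_. e)"
  define C where "C = Matrix.mat m m (\<lambda>(i, j). B $$ (Suc i, Suc j))"
  have E: "E \<in> carrier_mat 1 1" and C: "C \<in> carrier_mat m m" by (auto simp: E_def C_def)
  have Bblock: "B = four_block_mat E (0\<^sub>m 1 m) (0\<^sub>m m 1) C"
  proof (rule eq_matI)
    fix i j assume "i < dim_row (four_block_mat E (0\<^sub>m 1 m) (0\<^sub>m m 1) C)"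
      "j < dim_col (four_block_mat E (0\<^sub>m 1 m) (0\<^sub>m m 1) C)"
    then have "i < Suc m" "j < Suc m" by (auto simp: E_def C_def)
    then show "B $$ (i, j) = four_block_mat E (0\<^sub>m 1 m) (0\<^sub>m m 1) C $$ (i, j)"
      using col[folded B_def] row by (cases i; cases j) (auto simp: E_def C_def)
  qed (use B in \<open>auto simp: E_def C_def\<close>)
  have "normal_mat C"
  proof -
    have "B * mat_adjoint B = mat_adjoint B * B" using nB by (simp add: normal_mat_def)
    then have eq: "four_block_mat (E * mat_adjoint E) (0\<^sub>m 1 m) (0\<^sub>m m 1) (C * mat_adjoint C) =
        four_block_mat (mat_adjoint E * E) (0\<^sub>m 1 m) (0\<^sub>m m 1) (mat_adjoint C * C)"
      unfolding Bblock using E C by (simp add: mat_adjoint_block_diag block_diag_mult)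
    have "C * mat_adjoint C = mat_adjoint C * C"
      by (rule block_diag_inject[OF _ _ _ _ eq])
        (rule mult_carrier_mat mat_adjoint_carrier E C)+
    then show ?thesis using C by (auto simp: normal_mat_def square_mat.simps)
  qed
  then obtain P where P: "P \<in> carrier_mat m m" and uP: "unitary_mat P" and dP: "diagonalizes P C"
    using Suc.IH[OF C] by blast
  define Q where "Q = four_block_mat (1\<^sub>m 1) (0\<^sub>m 1 m) (0\<^sub>m m 1) P"
  have Q: "Q \<in> carrier_mat (Suc m) (Suc m)"
    using four_block_carrier_mat[OF one_carrier_mat[of 1] P] by (simp add: Q_def)
  have one: "mat_adjoint (1\<^sub>m 1) = (1\<^sub>m 1 :: complex mat)" by (rule eq_matI) auto
  have Q': "mat_adjoint Q = four_block_mat (1\<^sub>m 1) (0\<^sub>m 1 m) (0\<^sub>m m 1) (mat_adjoint P)"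
    unfolding Q_def by (subst mat_adjoint_block_diag) (use P one in auto)
  have uQ: "unitary_mat Q"
  proof (rule unitary_matI[OF Q])
    show "mat_adjoint Q * Q = 1\<^sub>m (Suc m)"
      unfolding Q' unfolding Q_def using P unitary_matD[OF uP P]
      by (simp add: block_diag_mult)
  qed
  have "mat_adjoint (W * Q) * A * (W * Q) = mat_adjoint Q * B * Q"
    using A W Q by (simp add: B_def mat_adjoint_mult[OF W Q]
        assoc_mult_mat[of _ "Suc m" "Suc m" _ "Suc m" _ "Suc m"]
        mult_carrier_mat[of _ "Suc m" "Suc m" _ "Suc m"])
  also have "\<dots> = four_block_mat E (0\<^sub>m 1 m) (0\<^sub>m m 1) (mat_adjoint P * C * P)"
    unfolding Q' Bblock unfolding Q_def using P E C
    by (simp add: block_diag_mult mult_carrier_mat[of _ m m _ m])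
  also have "diagonal_mat \<dots>"
    using dP E P C by (auto simp: diagonalizes_def diagonal_mat_def E_def)
  finally have "diagonalizes (W * Q) A" by (simp add: diagonalizes_def)
  then show ?case using unitary_mat_mult[OF uW uQ W Q] mult_carrier_mat[OF W Q] by blast
qed

section \<open>Passing from a diagonalization of a function of the matrix to the matrix\<close>

text \<open>
  Let \<open>A\<close> and \<open>N\<close> be diagonal in the common basis \<open>V\<close>, with eigenvalues \<open>l\<^sub>i\<close> and \<open>t\<^sub>i\<close>, where \<open>t\<^sub>i\<close> determines
  \<open>l\<^sub>i\<close>; so \<open>A\<close> is a function of \<open>N\<close>. The change of basis \<open>W = V\<^sup>* U\<close> to another eigenbasis \<open>U\<close> of \<open>N\<close>
  can only mix indices \<open>i\<close> with equal \<open>t\<^sub>i\<close>, hence with equal \<open>l\<^sub>i\<close>. So in each off-diagonal entry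
  \<open>\<Sum>\<^sub>i l\<^sub>i cnj W\<^sub>i\<^sub>j W\<^sub>i\<^sub>k\<close> of \<open>U\<^sup>* A U\<close> all the contributing \<open>l\<^sub>i\<close> agree, and the entry is a multiple of the
  inner product of two different columns of the unitary matrix \<open>W\<close>, which vanishes.
\<close>
lemma diagonalizes_of_coarser_diagonalization:
  assumes A: "A \<in> carrier_mat n n" and N: "N \<in> carrier_mat n n"
    and V: "V \<in> carrier_mat n n" "unitary_mat V" and U: "U \<in> carrier_mat n n" "unitary_mat U"
    and VA: "diagonalizes V A" and VN: "diagonalizes V N" and UN: "diagonalizes U N"
    and sep: "\<And>i j. i < n \<Longrightarrow> j < n \<Longrightarrow>
      (mat_adjoint V * N * V) $$ (i, i) = (mat_adjoint V * N * V) $$ (j, j) \<Longrightarrow>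
      (mat_adjoint V * A * V) $$ (i, i) = (mat_adjoint V * A * V) $$ (j, j)"
  shows "diagonalizes U A"
proof -
  define L where "L = mat_adjoint V * A * V"
  define T where "T = mat_adjoint V * N * V"
  define D where "D = mat_adjoint U * N * U"
  define W where "W = mat_adjoint V * U"
  note VU_carr = V(1) U(1) mat_adjoint_carrier[OF V(1)] mat_adjoint_carrier[OF U(1)]
  have L: "L \<in> carrier_mat n n" and T: "T \<in> carrier_mat n n"
    and D: "D \<in> carrier_mat n n" and W: "W \<in> carrier_mat n n"
    using A N VU_carr by (auto simp: L_def T_def D_def W_def)
  have Ld: "L $$ (i, j) = 0" if "i < n" "j < n" "i \<noteq> j" for i j
    using VA L that by (auto simp: diagonalizes_def diagonal_mat_def L_def)
  have Td: "T $$ (i, j) = 0" if "i < n" "j < n" "i \<noteq> j" for i j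
    using VN T that by (auto simp: diagonalizes_def diagonal_mat_def T_def)
  have Dd: "D $$ (i, j) = 0" if "i < n" "j < n" "i \<noteq> j" for i j
    using UN D that by (auto simp: diagonalizes_def diagonal_mat_def D_def)
  have W': "mat_adjoint W = mat_adjoint U * V"
    unfolding W_def by (subst mat_adjoint_mult[of _ n n _ n]) (use VU_carr in auto)
  have "T * W = mat_adjoint V * (N * U)"
    unfolding T_def W_def using N VU_carr unitary_mult_adjoint_cancel[OF V(2,1) U(1)]
    by (simp add: assoc_mult_mat[of _ n n _ n _ n] mult_carrier_mat[of _ n n _ n])
  moreover have "W * D = mat_adjoint V * (N * U)"
    unfolding D_def W_def
    using N VU_carr unitary_mult_adjoint_cancel[OF U(2,1) mult_carrier_mat[OF N U(1)]]
    by (simp add: assoc_mult_mat[of _ n n _ n _ n] mult_carrier_mat[of _ n n _ n])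
  ultimately have TW: "T * W = W * D" by simp
  have supp: "T $$ (i, i) = D $$ (j, j)"
    if i: "i < n" and j: "j < n" and nz: "W $$ (i, j) \<noteq> 0" for i j
  proof -
    have "(T * W) $$ (i, j) = (\<Sum>k\<in>{i}. T $$ (i, k) * W $$ (k, j))"
      unfolding index_mult_mat_sum[OF T W i j] using i Td
      by (intro sum.mono_neutral_right) auto
    moreover have "(W * D) $$ (i, j) = (\<Sum>k\<in>{j}. W $$ (i, k) * D $$ (k, j))"
      unfolding index_mult_mat_sum[OF W D i j] using j Dd
      by (intro sum.mono_neutral_right) auto
    ultimately have "T $$ (i, i) * W $$ (i, j) = W $$ (i, j) * D $$ (j, j)"
      using TW by auto
    then show ?thesis using nz by simp
  qed
  have WW: "mat_adjoint W * W = 1\<^sub>m n"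
    unfolding W' unfolding W_def
    using VU_carr unitary_mult_adjoint_cancel[OF V(2,1) U(1)] unitary_matD(1)[OF U(2,1)]
    by (simp add: assoc_mult_mat[of _ n n _ n _ n] mult_carrier_mat[of _ n n _ n])
  have UAU: "mat_adjoint U * A * U = mat_adjoint W * (L * W)"
    unfolding W' unfolding W_def L_def
    using A VU_carr unitary_mult_adjoint_cancel[OF V(2,1) U(1)]
      unitary_mult_adjoint_cancel[OF V(2,1) mult_carrier_mat[OF A U(1)]]
    by (simp add: assoc_mult_mat[of _ n n _ n _ n] mult_carrier_mat[of _ n n _ n])
  have "(mat_adjoint W * (L * W)) $$ (j, k) = 0" if jk: "j < n" "k < n" "j \<noteq> k" for j k
  proof -
    have LW: "(L * W) $$ (i, k) = L $$ (i, i) * W $$ (i, k)" if i: "i < n" for i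
    proof -
      have "(L * W) $$ (i, k) = (\<Sum>l\<in>{i}. L $$ (i, l) * W $$ (l, k))"
        unfolding index_mult_mat_sum[OF L W i jk(2)] using i Ld
        by (intro sum.mono_neutral_right) auto
      then show ?thesis by simp
    qed
    have expand: "(mat_adjoint W * (L * W)) $$ (j, k) =
        (\<Sum>i<n. L $$ (i, i) * (cnj (W $$ (i, j)) * W $$ (i, k)))"
      unfolding index_mult_mat_sum[OF mat_adjoint_carrier[OF W] mult_carrier_mat[OF L W] jk(1,2)]
      using W jk by (intro sum.cong) (auto simp: LW)
    obtain c where c: "\<And>i. i < n \<Longrightarrow> W $$ (i, j) \<noteq> 0 \<Longrightarrow> W $$ (i, k) \<noteq> 0 \<Longrightarrow> L $$ (i, i) = c"
    proof (cases "\<exists>i<n. W $$ (i, j) \<noteq> 0 \<and> W $$ (i, k) \<noteq> 0")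
      case True
      then obtain i0 where i0: "i0 < n" "W $$ (i0, j) \<noteq> 0" by blast
      have "L $$ (i, i) = L $$ (i0, i0)" if "i < n" "W $$ (i, j) \<noteq> 0" for i
        unfolding L_def using supp[OF that(1) jk(1) that(2)] supp[OF i0(1) jk(1) i0(2)]
        by (intro sep that(1) i0(1)) (simp flip: T_def)
      then show ?thesis using that by blast
    qed (use that in blast)
    have "(\<Sum>i<n. L $$ (i, i) * (cnj (W $$ (i, j)) * W $$ (i, k))) =
        c * (\<Sum>i<n. cnj (W $$ (i, j)) * W $$ (i, k))"
      unfolding sum_distrib_left using c by (intro sum.cong) auto
    also have "(\<Sum>i<n. cnj (W $$ (i, j)) * W $$ (i, k)) = (mat_adjoint W * W) $$ (j, k)"
      unfolding index_mult_mat_sum[OF mat_adjoint_carrier[OF W] W jk(1,2)]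
      using W jk by (intro sum.cong) auto
    finally show ?thesis using expand jk by (simp add: WW)
  qed
  then show ?thesis
    using W L by (auto simp: diagonalizes_def diagonal_mat_def UAU)
qed

text \<open>
  The entries of \<open>a H + b \<i>S\<close> in the basis \<open>V\<close>. At a diagonal entry \<open>\<lambda>\<close> of \<open>L\<close> the right-hand side is
  \<open>a Re \<lambda> - b Im \<lambda>\<close>, and it vanishes off the diagonal if \<open>L\<close> is diagonal.
\<close>
lemma unitary_conj_combination:
  fixes A V :: "complex mat" and a b :: real
  assumes A: "A \<in> carrier_mat n n" and V: "V \<in> carrier_mat n n" and ij: "i < n" "j < n"
  defines "N \<equiv> complex_of_real a \<cdot>\<^sub>m herm_part A + complex_of_real b \<cdot>\<^sub>m (\<i> \<cdot>\<^sub>m skew_part A)"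
    and "L \<equiv> mat_adjoint V * A * V"
  shows "(mat_adjoint V * N * V) $$ (i, j) =
    of_real a * (L $$ (i, j) + cnj (L $$ (j, i))) / 2 +
    \<i> * of_real b * (L $$ (i, j) - cnj (L $$ (j, i))) / 2"
proof -
  \<comment> \<open>Collect the combination by \<open>A\<close> and its adjoint, on both of which conjugation by \<open>V\<close> is easy.\<close>
  define x where "x = (of_real a + \<i> * of_real b) / 2"
  define y where "y = (of_real a - \<i> * of_real b) / 2"
  have A': "mat_adjoint A \<in> carrier_mat n n" and V': "mat_adjoint V \<in> carrier_mat n n"
    using A V by auto
  have L: "L \<in> carrier_mat n n" using A V V' by (auto simp: L_def)
  have N: "N = x \<cdot>\<^sub>m A + y \<cdot>\<^sub>m mat_adjoint A"
    using A A' by (intro eq_matI)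
      (auto simp: N_def herm_part_def skew_part_def x_def y_def field_simps)
  have xA: "x \<cdot>\<^sub>m A \<in> carrier_mat n n" and yA: "y \<cdot>\<^sub>m mat_adjoint A \<in> carrier_mat n n"
    using A A' by auto
  have "mat_adjoint V * N * V = x \<cdot>\<^sub>m L + y \<cdot>\<^sub>m (mat_adjoint V * mat_adjoint A * V)"
    unfolding N L_def mult_add_distrib_mat[OF V' xA yA]
      add_mult_distrib_mat[OF mult_carrier_mat[OF V' xA] mult_carrier_mat[OF V' yA] V]
    unfolding mult_smult_distrib[OF V' A] mult_smult_distrib[OF V' A']
      mult_smult_assoc_mat[OF mult_carrier_mat[OF V' A] V]
      mult_smult_assoc_mat[OF mult_carrier_mat[OF V' A'] V] ..
  also have "mat_adjoint V * mat_adjoint A * V = mat_adjoint L"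
    unfolding L_def by (rule mat_adjoint_conj[OF A V, symmetric])
  finally show ?thesis using L ij by (auto simp: x_def y_def field_simps)
qed

section \<open>Random linear combinations almost surely do not vanish\<close>

text \<open>
  By independence the pair \<open>(X, Y)\<close> has a density with respect to planar Lebesgue measure, for which
  the line \<open>p x + q y = 0\<close> is a null set.
\<close>
lemma (in prob_space) AE_nontrivial_linear_combination_nonzero:
  fixes X Y :: "'a \<Rightarrow> real" and p q :: real
  assumes X: "distributed M lborel X f" and Y: "distributed M lborel Y g"
    and indep: "indep_var borel X borel Y" and pq: "p \<noteq> 0 \<or> q \<noteq> 0"
  shows "AE \<omega> in M. p * X \<omega> + q * Y \<omega> \<noteq> 0"
proof -
  \<comment> \<open>Independence only looks at the measurable sets, which are the same for \<open>borel\<close> and \<open>lborel\<close>;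
    joint densities are stated over the latter.\<close>
  have indep': "indep_var lborel X lborel Y"
    using indep by (simp add: indep_var_def indep_vars_def2 bool.case_distrib cong: bool.case_cong)
  have XY: "distributed M (lborel \<Otimes>\<^sub>M lborel) (\<lambda>\<omega>. (X \<omega>, Y \<omega>)) (\<lambda>(x, y). f x * g y)"
    by (rule distributed_joint_indep[OF lborel.sigma_finite_measure_axioms
          lborel.sigma_finite_measure_axioms X Y indep'])
  have "negligible {z :: real \<times> real. (p, q) \<bullet> z = 0}"
    using pq by (intro negligible_hyperplane) (auto simp: zero_prod_def)
  then have "AE z in lebesgue. z \<notin> {z :: real \<times> real. (p, q) \<bullet> z = 0}"
    by (intro AE_not_in) (simp add: negligible_iff_null_sets)
  then have "AE z in lborel. (p, q) \<bullet> (z :: real \<times> real) \<noteq> 0"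
    by (simp add: AE_completion_iff)
  then have null: "AE z in lborel \<Otimes>\<^sub>M lborel. p * fst z + q * snd z \<noteq> (0 :: real)"
    unfolding lborel_prod by (simp add: inner_prod_def)
  have "AE \<omega> in M. p * fst (X \<omega>, Y \<omega>) + q * snd (X \<omega>, Y \<omega>) \<noteq> 0"
    by (subst distributed_AE2[OF XY]) (use null in auto)
  then show ?thesis by simp
qed

section \<open>Correctness of the randomized diagonalization\<close>

theorem theorem1:
  fixes n :: nat and A :: "complex mat"
    and M :: "'w measure" and \<mu>\<^sub>H \<mu>\<^sub>S :: "'w \<Rightarrow> real"
    and U :: "'w \<Rightarrow> complex mat"
  assumes "A \<in> carrier_mat n n"
    and "normal_mat A"
    and "prob_space M"
    and "distributed M lborel \<mu>\<^sub>H (\<lambda>x. ennreal (std_normal_density x))"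
    and "distributed M lborel \<mu>\<^sub>S (\<lambda>x. ennreal (std_normal_density x))"
    and "prob_space.indep_var M borel \<mu>\<^sub>H borel \<mu>\<^sub>S"
    and "\<And>\<omega>. \<omega> \<in> space M \<Longrightarrow> rand_diag_output A (\<mu>\<^sub>H \<omega>) (\<mu>\<^sub>S \<omega>) (U \<omega>)"
  shows "AE \<omega> in M. diagonalizes (U \<omega>) A"
proof -
  interpret prob_space M by fact
  note A = assms(1)
  obtain V where V: "V \<in> carrier_mat n n" "unitary_mat V" and VA: "diagonalizes V A"
    using normal_mat_unitarily_diagonalizable[OF assms(1,2)] by blast
  define L where "L = mat_adjoint V * A * V"
  have L: "L \<in> carrier_mat n n" using A V(1) by (auto simp: L_def)
  have offdiag: "L $$ (i, j) = 0" if "i < n" "j < n" "i \<noteq> j" for i j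
    using VA L that by (auto simp: diagonalizes_def diagonal_mat_def L_def)
  define eig where "eig i = L $$ (i, i)" for i
  \<comment> \<open>Different eigenvalues of \<open>A\<close> almost surely stay different in the random combination.\<close>
  have "AE \<omega> in M. \<forall>i\<in>{..<n}. \<forall>j\<in>{..<n}. eig i \<noteq> eig j \<longrightarrow>
      Re (eig i - eig j) * \<mu>\<^sub>H \<omega> + (- Im (eig i - eig j)) * \<mu>\<^sub>S \<omega> \<noteq> 0"
  proof (intro AE_finite_allI finite_lessThan)
    fix i j
    show "AE \<omega> in M. eig i \<noteq> eig j \<longrightarrow>
        Re (eig i - eig j) * \<mu>\<^sub>H \<omega> + (- Im (eig i - eig j)) * \<mu>\<^sub>S \<omega> \<noteq> 0"
    proof (cases "eig i = eig j")
      case False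
      then have "Re (eig i - eig j) \<noteq> 0 \<or> - Im (eig i - eig j) \<noteq> 0"
        by (auto simp: complex_eq_iff)
      from AE_nontrivial_linear_combination_nonzero[OF assms(4,5,6) this]
      show ?thesis by (rule AE_mp) simp
    qed simp
  qed
  then show ?thesis
  proof (rule AE_mp, intro AE_I2 impI)
    fix \<omega> assume \<omega>: "\<omega> \<in> space M"
      and generic: "\<forall>i\<in>{..<n}. \<forall>j\<in>{..<n}. eig i \<noteq> eig j \<longrightarrow>
        Re (eig i - eig j) * \<mu>\<^sub>H \<omega> + (- Im (eig i - eig j)) * \<mu>\<^sub>S \<omega> \<noteq> 0"
    define N where "N = complex_of_real (\<mu>\<^sub>H \<omega>) \<cdot>\<^sub>m herm_part A +
      complex_of_real (\<mu>\<^sub>S \<omega>) \<cdot>\<^sub>m (\<i> \<cdot>\<^sub>m skew_part A)"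
    have N: "N \<in> carrier_mat n n" using A by (auto simp: N_def herm_part_def skew_part_def)
    have U: "U \<omega> \<in> carrier_mat n n" "unitary_mat (U \<omega>)" and UN: "diagonalizes (U \<omega>) N"
      using assms(7)[OF \<omega>] A by (auto simp: rand_diag_output_def N_def)
    note conj = unitary_conj_combination[OF A V(1), of _ _ "\<mu>\<^sub>H \<omega>" "\<mu>\<^sub>S \<omega>", folded N_def L_def]
    have VN: "diagonalizes V N"
      using N V(1) offdiag
      by (auto simp: diagonalizes_def diagonal_mat_def conj simp del: index_mult_mat(1))
    have diag: "(mat_adjoint V * N * V) $$ (i, i) =
        of_real (\<mu>\<^sub>H \<omega> * Re (eig i) - \<mu>\<^sub>S \<omega> * Im (eig i))" if "i < n" for i
      using that by (simp add: conj eig_def complex_eq_iff)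
    show "diagonalizes (U \<omega>) A"
    proof (rule diagonalizes_of_coarser_diagonalization[OF A N V U VA VN UN])
      fix i j assume ij: "i < n" "j < n"
        and "(mat_adjoint V * N * V) $$ (i, i) = (mat_adjoint V * N * V) $$ (j, j)"
      then have "\<mu>\<^sub>H \<omega> * Re (eig i) - \<mu>\<^sub>S \<omega> * Im (eig i) = \<mu>\<^sub>H \<omega> * Re (eig j) - \<mu>\<^sub>S \<omega> * Im (eig j)"
        by (simp only: diag of_real_eq_iff)
      then have "Re (eig i - eig j) * \<mu>\<^sub>H \<omega> + (- Im (eig i - eig j)) * \<mu>\<^sub>S \<omega> = 0"
        by (simp add: algebra_simps)
      then have "eig i = eig j" using generic ij by blast
      then show "(mat_adjoint V * A * V) $$ (i, i) = (mat_adjoint V * A * V) $$ (j, j)"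
        by (simp add: eig_def L_def)
    qed
  qed
qed

end
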